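(* Let $n\ge 1$ and let $\mathscr{C}_n$ be the set of complex $n\times n$ matrices with operator norm strictly less than $1$. Let $d: \mathscr{C}_n \times \mathscr{C}_n \to [0,\infty)$ be defined by $$d^2(A, B) := \log \frac{|\det(I-A^*B)|}{\sqrt{\det(I-A^*A)}\sqrt{\det(I-B^*B)}},\qquad A, B \in \mathscr{C}_n.$$ Then $(\mathscr{C}_n,d)$ is a metric space.
   Context: $d(A,B)$ is the nonnegative square root of the right-hand side. Part of the claim is that the right-hand side is nonnegative, so that $d$ is well defined. *)

theory Defs
  imports "HOL-Analysis.Analysis"
begin

definition conj_transpose :: "complex^'n^'m \<Rightarrow> complex^'m^'n" where
  "conj_transpose A = (\<chi> i j. cnj (A $ j $ i))"

text \<open>
  The norm on \<^typ>\<open>complex^'n\<close> is the Euclidean one, so \<^const>\<open>onorm\<close> yields the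
  operator norm induced by it.
\<close>

definition contraction_ball :: "(complex^'n^'n) set" where
  "contraction_ball = {A. onorm (\<lambda>x. A *v x) < 1}"

text \<open>
  On the diagonal the determinants are positive real numbers, represented as complex
  ones; \<^const>\<open>Re\<close> only changes the type.
\<close>

definition dist_sq :: "complex^'n^'n \<Rightarrow> complex^'n^'n \<Rightarrow> real" where
  "dist_sq A B =
     ln (cmod (det (mat 1 - conj_transpose A ** B)) /
         (sqrt (Re (det (mat 1 - conj_transpose A ** A))) *
          sqrt (Re (det (mat 1 - conj_transpose B ** B)))))"

text \<open>
  The locale \<^locale>\<open>Metric_space\<close> demands nonnegativity and symmetry also outside of the
  carrier, hence the irrelevant value 0 there.
\<close>

definition contraction_dist :: "complex^'n^'n \<Rightarrow> complex^'n^'n \<Rightarrow> real" where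
  "contraction_dist A B =
     (if A \<in> contraction_ball \<and> B \<in> contraction_ball then sqrt (dist_sq A B) else 0)"

end

theory Submission
  imports Defs
begin

text \<open>
  Moebius transformations of the ball leave \<^const>\<open>dist_sq\<close> invariant and move the middle point
  of the triangle inequality to 0. With $p = - \log \det (I - A^*A)$ and
  $q = - \log \det (I - C^*C)$ it then reads $\log |\det (I - A^*C)| \le \sqrt{pq}$. Since
  $- \log |\det (I - X)| = \sum_{k \ge 1} \mathrm{Re}\, \mathrm{tr} (X^k) / k$, this follows by the
  Cauchy--Schwarz inequality from
  $|\mathrm{Re}\, \mathrm{tr} (A^*C)^k|^2 \le \mathrm{tr} (A^*A)^k \, \mathrm{tr} (C^*C)^k$,
  which is a chessboard estimate.
\<close>

section \<open>The adjoint and the operator norm\<close>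

text \<open>For k \<ge> 2 the trace bound is not a single Cauchy-Schwarz inequality: cutting the
  product in tr (\<open>A\<^sup>\<dagger> ** C\<close>)^k in half yields traces of palindromes that
  still mix A and C, and \<open>A\<^sup>\<dagger> ** C\<close> need not be normal. Hence all
  products in which adjoint and plain factors alternate are treated together, a class closed under
  reflection, over which a maximum can be taken. This bounds the mixed trace only by the larger of
  the two pure ones; a rescaling of A and C turns that maximum into the geometric mean.

  Nonnegativity and definiteness come from the same tools: once B is moved to 0,
  \<open>dist_sq\<close> is half the sum of a series with nonnegative terms, the first of which is a
  squared Frobenius norm.

  Two norms therefore occur. The norm of the matrix type is the Frobenius norm, which carries the
  trace estimates; \<open>opnorm\<close> describes the ball and controls convergence.\<close>

notation conj_transpose (\<open>_\<^sup>\<dagger>\<close> [1000] 1000)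

abbreviation opnorm :: "complex^'n^'m \<Rightarrow> real" where
  "opnorm A \<equiv> onorm (\<lambda>x. A *v x)"

section \<open>Matrix arithmetic and the adjoint\<close>

lemma matrix_add_rdistrib: "(B + C) ** A = B ** A + (C :: 'a::semiring_1^'n^'m) ** A"
  by (simp add: matrix_matrix_mult_def vec_eq_iff sum.distrib algebra_simps)

lemma matrix_diff_ldistrib: "A ** (B - C) = A ** B - A ** (C :: 'a::ring_1^'k^'n)"
  by (simp add: matrix_matrix_mult_def vec_eq_iff sum_subtractf algebra_simps)

lemma matrix_diff_rdistrib: "(B - C) ** A = B ** A - (C :: 'a::ring_1^'n^'m) ** A"
  by (simp add: matrix_matrix_mult_def vec_eq_iff sum_subtractf algebra_simps)

lemma matrix_zero_mult [simp]: "0 ** A = (0 :: 'a::semiring_1^'k^'n)"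
  by (simp add: matrix_matrix_mult_def vec_eq_iff)

lemma matrix_mult_zero [simp]: "A ** 0 = (0 :: 'a::semiring_1^'k^'n)"
  by (simp add: matrix_matrix_mult_def vec_eq_iff)

lemma mat_mult_component: "(mat z ** A) $ i $ j = z * (A $ i $ j)"
proof -
  have "(mat z ** A) $ i $ j = (\<Sum>k\<in>UNIV. if k = i then z * A $ k $ j else 0)"
    unfolding matrix_matrix_mult_def mat_def vec_lambda_beta by (rule sum.cong) auto
  then show ?thesis
    by simp
qed

lemma mat_commute: "A ** mat z = mat z ** (A :: 'a::comm_semiring_1^'n^'m)"
proof -
  have "(A ** mat z) $ i $ j = z * (A $ i $ j)" for i j
  proof -
    have "(A ** mat z) $ i $ j = (\<Sum>k\<in>UNIV. if k = j then A $ i $ k * z else 0)"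
      unfolding matrix_matrix_mult_def mat_def vec_lambda_beta by (rule sum.cong) auto
    then show ?thesis
      by (simp add: mult.commute)
  qed
  then show ?thesis
    by (simp add: vec_eq_iff mat_mult_component)
qed

lemma conj_transpose_component [simp]: "A\<^sup>\<dagger> $ i $ j = cnj (A $ j $ i)"
  by (simp add: conj_transpose_def)

lemma conj_transpose_conj_transpose [simp]: "A\<^sup>\<dagger>\<^sup>\<dagger> = A"
  by (simp add: vec_eq_iff)

lemma conj_transpose_mult: "(A ** B)\<^sup>\<dagger> = B\<^sup>\<dagger> ** A\<^sup>\<dagger>"
  by (simp add: vec_eq_iff matrix_matrix_mult_def mult.commute)

lemma conj_transpose_diff: "(A - B)\<^sup>\<dagger> = A\<^sup>\<dagger> - B\<^sup>\<dagger>"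
  by (simp add: vec_eq_iff)

lemma conj_transpose_add: "(A + B)\<^sup>\<dagger> = A\<^sup>\<dagger> + B\<^sup>\<dagger>"
  by (simp add: vec_eq_iff)

lemma conj_transpose_scaleR: "(r *\<^sub>R A)\<^sup>\<dagger> = r *\<^sub>R A\<^sup>\<dagger>"
  by (simp add: vec_eq_iff)

lemma conj_transpose_mat_1 [simp]: "(mat 1 :: complex^'n^'n)\<^sup>\<dagger> = mat 1"
  by (simp add: vec_eq_iff mat_def)

lemma conj_transpose_0 [simp]: "0\<^sup>\<dagger> = 0"
  by (simp add: vec_eq_iff)

lemma det_conj_transpose: "det (A\<^sup>\<dagger>) = cnj (det A)"
proof -
  have "det (A\<^sup>\<dagger>) = det (transpose (A\<^sup>\<dagger>))"
    by simp
  also have "\<dots> = cnj (det A)"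
    by (simp add: det_def transpose_def)
  finally show ?thesis .
qed

section \<open>The Frobenius inner product and adjointness\<close>

lemma inner_matrix_eq_trace: "inner A B = Re (trace (A\<^sup>\<dagger> ** B))"
proof -
  have "inner A B = (\<Sum>i\<in>UNIV. \<Sum>j\<in>UNIV. Re (cnj (A $ i $ j) * B $ i $ j))"
    by (simp add: inner_vec_def inner_complex_def)
  also have "\<dots> = (\<Sum>j\<in>UNIV. \<Sum>i\<in>UNIV. Re (cnj (A $ i $ j) * B $ i $ j))"
    by (rule sum.swap)
  also have "\<dots> = Re (trace (A\<^sup>\<dagger> ** B))"
    by (simp add: trace_def matrix_matrix_mult_def)
  finally show ?thesis .
qed

lemma norm_conj_transpose: "norm (A\<^sup>\<dagger>) = norm A"
  by (simp add: norm_eq_sqrt_inner inner_matrix_eq_trace trace_mul_sym[of A])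

lemma norm_matrix_square: "(norm A)\<^sup>2 = Re (trace (A\<^sup>\<dagger> ** A))"
  by (simp add: power2_norm_eq_inner inner_matrix_eq_trace)

lemma abs_Re_trace_mult_le: "\<bar>Re (trace (A ** B))\<bar> \<le> norm A * norm B"
  using Cauchy_Schwarz_ineq2[of "A\<^sup>\<dagger>" B]
  by (simp add: inner_matrix_eq_trace norm_conj_transpose)

lemma inner_matrix_vector: "inner (A *v x) y = inner x (A\<^sup>\<dagger> *v (y :: complex^'m))"
proof -
  have "inner (A *v x) y = (\<Sum>i\<in>UNIV. \<Sum>j\<in>UNIV. Re (A $ i $ j * x $ j * cnj (y $ i)))"
    by (simp add: inner_vec_def matrix_vector_mult_def inner_complex_def sum_distrib_right
        sum_distrib_left sum.distrib [symmetric] algebra_simps)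
  also have "\<dots> = (\<Sum>j\<in>UNIV. \<Sum>i\<in>UNIV. Re (A $ i $ j * x $ j * cnj (y $ i)))"
    by (rule sum.swap)
  also have "\<dots> = inner x (A\<^sup>\<dagger> *v y)"
    by (simp add: inner_vec_def matrix_vector_mult_def inner_complex_def sum_distrib_right
        sum_distrib_left sum.distrib [symmetric] algebra_simps)
  finally show ?thesis .
qed

section \<open>The operator norm and its comparison with the Frobenius norm\<close>

lemma bounded_linear_matrix_vector: "bounded_linear (\<lambda>x. (A :: complex^'n^'m) *v x)"
  by (simp add: linear_linear)

lemma norm_matrix_vector_le: "norm (A *v x) \<le> opnorm A * norm x"
  by (rule onorm[OF bounded_linear_matrix_vector])

lemma opnorm_nonneg [simp]: "0 \<le> opnorm A"
  by (rule onorm_pos_le[OF bounded_linear_matrix_vector])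

lemma opnorm_le: "(\<And>x. norm (A *v x) \<le> c * norm x) \<Longrightarrow> opnorm A \<le> c"
  by (rule onorm_le)

lemma opnorm_mult: "opnorm (A ** B) \<le> opnorm A * opnorm B"
proof (rule opnorm_le)
  fix x
  have "norm (A *v (B *v x)) \<le> opnorm A * (opnorm B * norm x)"
    by (meson mult_left_mono norm_matrix_vector_le opnorm_nonneg order_trans)
  then show "norm ((A ** B) *v x) \<le> opnorm A * opnorm B * norm x"
    by (simp add: matrix_vector_mul_assoc mult.assoc)
qed

lemma opnorm_conj_transpose_le: "opnorm (A\<^sup>\<dagger>) \<le> opnorm A"
proof (rule opnorm_le)
  fix y
  have "(norm (A\<^sup>\<dagger> *v y))\<^sup>2 = inner (A *v (A\<^sup>\<dagger> *v y)) y"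
    by (simp add: inner_matrix_vector power2_norm_eq_inner)
  also have "\<dots> \<le> norm (A *v (A\<^sup>\<dagger> *v y)) * norm y"
    by (rule norm_cauchy_schwarz)
  also have "\<dots> \<le> (opnorm A * norm (A\<^sup>\<dagger> *v y)) * norm y"
    by (intro mult_right_mono norm_matrix_vector_le norm_ge_zero)
  finally have "norm (A\<^sup>\<dagger> *v y) * norm (A\<^sup>\<dagger> *v y) \<le> norm (A\<^sup>\<dagger> *v y) * (opnorm A * norm y)"
    by (simp add: power2_eq_square mult_ac)
  then show "norm (A\<^sup>\<dagger> *v y) \<le> opnorm A * norm y"
    by (cases "norm (A\<^sup>\<dagger> *v y) = 0") auto
qed

lemma norm_component_le_opnorm: "norm (A $ i $ j) \<le> opnorm A"
proof -
  have "norm (A $ i $ j) = norm ((A *v axis j 1) $ i)"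
    by (simp add: matrix_vector_mult_def axis_def if_distrib[of "\<lambda>x. _ * x"] cong: if_cong)
  also have "\<dots> \<le> norm (A *v axis j 1)"
    by (rule Finite_Cartesian_Product.norm_nth_le)
  also have "\<dots> \<le> opnorm A"
    using norm_matrix_vector_le[of A "axis j 1"] by (simp add: norm_eq_sqrt_inner[of "axis j 1"] inner_axis_axis)
  finally show ?thesis .
qed

text \<open>Crude, but it serves only for convergence: summability of the trace series and vanishing
  of the Neumann remainder.\<close>

lemma norm_trace_le: "norm (trace (A :: complex^'n^'n)) \<le> CARD('n) * opnorm A"
  unfolding trace_def using sum_norm_bound[of UNIV "\<lambda>i. A $ i $ i" "opnorm A"]
  by (simp add: norm_component_le_opnorm)

lemma norm_matrix_square_columns: "(norm (A :: complex^'n^'m))\<^sup>2 = (\<Sum>j\<in>UNIV. (norm (column j A))\<^sup>2)"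
proof -
  have "(norm A)\<^sup>2 = (\<Sum>i\<in>UNIV. \<Sum>j\<in>UNIV. (norm (A $ i $ j))\<^sup>2)"
    by (simp add: norm_vec_def L2_set_def sum_nonneg)
  also have "\<dots> = (\<Sum>j\<in>UNIV. \<Sum>i\<in>UNIV. (norm (A $ i $ j))\<^sup>2)"
    by (rule sum.swap)
  also have "\<dots> = (\<Sum>j\<in>UNIV. (norm (column j A))\<^sup>2)"
    by (simp add: norm_vec_def L2_set_def sum_nonneg column_def)
  finally show ?thesis .
qed

text \<open>A acts on each column of B separately, and the squared Frobenius norm is the sum of the
  squared column norms.\<close>

lemma norm_matrix_mult_le_opnorm_norm: "norm (A ** B) \<le> opnorm A * norm B"
proof (rule power2_le_imp_le)
  have col: "column j (A ** B) = A *v column j B" for j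
    by (simp add: vec_eq_iff column_def matrix_matrix_mult_def matrix_vector_mult_def)
  have "(norm (A ** B))\<^sup>2 \<le> (\<Sum>j\<in>UNIV. (opnorm A * norm (column j B))\<^sup>2)"
    unfolding norm_matrix_square_columns col
    by (intro sum_mono power_mono norm_matrix_vector_le norm_ge_zero)
  also have "\<dots> = (opnorm A * norm B)\<^sup>2"
    by (simp add: power_mult_distrib sum_distrib_left norm_matrix_square_columns)
  finally show "(norm (A ** B))\<^sup>2 \<le> (opnorm A * norm B)\<^sup>2" .
qed simp

lemma norm_matrix_mult_le_norm_opnorm: "norm (A ** B) \<le> norm A * opnorm B"
proof -
  have "norm (A ** B) = norm (B\<^sup>\<dagger> ** A\<^sup>\<dagger>)"
    by (metis conj_transpose_mult norm_conj_transpose)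
  also have "\<dots> \<le> opnorm (B\<^sup>\<dagger>) * norm A"
    using norm_matrix_mult_le_opnorm_norm[of "B\<^sup>\<dagger>" "A\<^sup>\<dagger>"] by (simp add: norm_conj_transpose)
  also have "\<dots> \<le> opnorm B * norm A"
    by (intro mult_right_mono opnorm_conj_transpose_le norm_ge_zero)
  finally show ?thesis
    by (simp add: mult.commute)
qed

lemma invertible_mat_1_minus:
  fixes X :: "complex^'n^'n"
  assumes "opnorm X < 1"
  shows "invertible (mat 1 - X)"
proof -
  have "x = 0" if "(mat 1 - X) *v x = 0" for x
  proof (rule ccontr)
    assume "x \<noteq> 0"
    have "X *v x = x"
      using that by (simp add: matrix_vector_mult_diff_rdistrib)
    then have "norm x \<le> opnorm X * norm x"
      by (metis norm_matrix_vector_le)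
    also have "\<dots> < norm x"
      using assms \<open>x \<noteq> 0\<close> by simp
    finally show False
      by simp
  qed
  then show ?thesis
    using matrix_left_invertible_ker invertible_left_inverse by blast
qed

section \<open>The logarithm of the determinant\<close>

primrec matrix_power :: "'a::semiring_1^'n^'n \<Rightarrow> nat \<Rightarrow> 'a^'n^'n" where
  "matrix_power A 0 = mat 1"
| "matrix_power A (Suc k) = A ** matrix_power A k"

lemma matrix_power_commute: "matrix_power A k ** A = matrix_power A (Suc k)"
  by (induction k) (simp_all flip: matrix_mul_assoc)

lemma opnorm_matrix_power: "opnorm (matrix_power A k) \<le> opnorm A ^ k"
proof (induction k)
  case (Suc k)
  have "opnorm (matrix_power A (Suc k)) \<le> opnorm A * opnorm (matrix_power A k)"
    by (simp add: opnorm_mult)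
  also have "\<dots> \<le> opnorm A ^ Suc k"
    by (simp add: Suc mult_left_mono)
  finally show ?case .
qed (simp add: onorm_le)

lemma opnorm_mat_mult: "opnorm (mat z ** (A :: complex^'n^'m)) \<le> norm z * opnorm A"
proof (rule opnorm_le)
  fix x
  have "(mat z ** A) *v x = z *s (A *v x)"
    by (simp add: vec_eq_iff matrix_vector_mult_def mat_mult_component sum_distrib_left mult.assoc)
  moreover have "norm (z *s y) = norm z * norm y" for y :: "complex^'m"
    by (simp add: norm_vec_def L2_set_def norm_mult power_mult_distrib
        sum_distrib_left [symmetric] real_sqrt_mult)
  ultimately show "norm ((mat z ** A) *v x) \<le> norm z * opnorm A * norm x"
    using norm_matrix_vector_le[of A x] by (simp add: mult.assoc mult_left_mono)
qed

section \<open>Jacobi's formula for the derivative of the determinant\<close>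

lemma has_field_derivative_det_at_0:
  fixes Y :: "complex^'n^'n"
  shows "((\<lambda>h. det (mat 1 + mat h ** Y)) has_field_derivative trace Y) (at 0)"
proof -
  define e :: "complex^'n^'n" where "e = mat 1"
  define g where "g p = (\<Sum>i\<in>UNIV. Y $ i $ p i * (\<Prod>j\<in>UNIV - {i}. e $ j $ p j))"
    for p :: "'n \<Rightarrow> 'n"
  have "((\<lambda>h. \<Prod>i\<in>UNIV. (mat 1 + mat h ** Y) $ i $ p i) has_field_derivative g p) (at 0)"
    for p :: "'n \<Rightarrow> 'n"
  proof -
    have "((\<lambda>h. \<Prod>i\<in>UNIV. e $ i $ p i + h * Y $ i $ p i) has_field_derivative
        (\<Sum>i\<in>UNIV. Y $ i $ p i * (\<Prod>j\<in>UNIV - {i}. e $ j $ p j + 0 * Y $ j $ p j))) (at 0)"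
      by (rule has_field_derivative_prod) (auto intro!: derivative_eq_intros)
    then show ?thesis
      by (simp add: g_def e_def mat_mult_component)
  qed
  then have "((\<lambda>h. det (mat 1 + mat h ** Y)) has_field_derivative
      (\<Sum>p\<in>{p. p permutes UNIV}. of_int (sign p) * g p)) (at 0)"
    unfolding det_def by (intro DERIV_sum DERIV_cmult)
  moreover have "(\<Sum>p\<in>{p. p permutes UNIV}. of_int (sign p) * g p) = trace Y"
  proof -
    \<comment> \<open>A permutation other than the identity moves at least two points,
      \<open>a\<close> and \<open>p a\<close>. Differentiation removes one factor of the product, so
      an off-diagonal entry of the identity matrix remains.\<close>
    have "g p = 0" if p: "p permutes UNIV" "p \<noteq> id" for p
    proof -
      obtain a where a: "p a \<noteq> a"
        using p(2) by (metis eq_id_iff)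
      have "p (p a) \<noteq> p a"
        using a p(1) by (metis permutes_inv_eq)
      have "(\<Prod>j\<in>UNIV - {i}. e $ j $ p j) = 0" for i
      proof -
        have "\<exists>j\<in>UNIV - {i}. e $ j $ p j = 0"
        proof (cases "i = a")
          case True
          then show ?thesis
            using a \<open>p (p a) \<noteq> p a\<close> by (intro bexI[of _ "p a"]) (auto simp: e_def mat_def)
        next
          case False
          then show ?thesis
            using a by (intro bexI[of _ a]) (auto simp: e_def mat_def)
        qed
        then show ?thesis
          by (intro prod_zero) auto
      qed
      then show ?thesis
        unfolding g_def by (simp only: mult_zero_right sum.neutral_const)
    qed
    then have "(\<Sum>p\<in>{p. p permutes UNIV}. of_int (sign p) * g p)
        = (\<Sum>p\<in>{id}. of_int (sign p) * g p)"
      by (intro sum.mono_neutral_right) (auto simp: permutes_id finite_permutations)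
    also have "\<dots> = trace Y"
      by (simp add: g_def trace_def e_def mat_def)
    finally show ?thesis .
  qed
  ultimately show ?thesis
    by simp
qed

text \<open>Reduction to the derivative at 0: as N inverts I - z X, the matrix I - w X factors as I
  - z X times I + (z - w) N X.\<close>

lemma has_field_derivative_det:
  fixes X N :: "complex^'n^'n"
  assumes N: "(mat 1 - mat z ** X) ** N = mat 1"
  shows "((\<lambda>w. det (mat 1 - mat w ** X)) has_field_derivative
    - (det (mat 1 - mat z ** X) * trace (N ** X))) (at z)"
proof -
  have eq: "det (mat 1 - mat w ** X)
      = det (mat 1 - mat z ** X) * det (mat 1 + mat (z - w) ** (N ** X))" for w
  proof -
    have "(mat 1 - mat z ** X) ** (mat 1 + mat (z - w) ** (N ** X))
       = (mat 1 - mat z ** X) + mat (z - w) ** (((mat 1 - mat z ** X) ** N) ** X)"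
      by (simp add: matrix_add_ldistrib matrix_mul_assoc mat_commute[of "mat 1 - mat z ** X" "z - w"])
    also have "\<dots> = mat 1 - mat w ** X"
      by (simp add: N vec_eq_iff mat_mult_component algebra_simps)
    finally show ?thesis
      by (metis det_mul)
  qed
  have "((\<lambda>h. det (mat 1 + mat h ** (N ** X))) has_field_derivative trace (N ** X)) (at (z - z))"
    using has_field_derivative_det_at_0 by simp
  then have "((\<lambda>w. det (mat 1 + mat (z - w) ** (N ** X))) has_field_derivative
      trace (N ** X) * (- 1)) (at z)"
    by (rule DERIV_chain2) (auto intro!: derivative_eq_intros)
  from DERIV_cmult[OF this, of "det (mat 1 - mat z ** X)"] show ?thesis
    by (simp flip: eq)
qed

section \<open>The power series of the logarithm of the determinant\<close>

lemma trace_mat_mult: "trace (mat z ** A) = z * trace A"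
  by (simp add: trace_def mat_mult_component sum_distrib_left)

lemma trace_power_bound:
  "norm (trace (matrix_power (X :: complex^'n^'n) k)) \<le> CARD('n) * opnorm X ^ k"
  by (rule order_trans[OF norm_trace_le mult_left_mono[OF opnorm_matrix_power]]) simp

text \<open>The Neumann series of the resolvent, taken under the trace so that only scalar series
  occur. Repeated substitution of I + z X N for N gives the partial sums with an exact remainder,
  which decays geometrically.\<close>

lemma trace_resolvent_sums:
  fixes X N :: "complex^'n^'n"
  assumes N: "(mat 1 - mat z ** X) ** N = mat 1" and "norm z * opnorm X < 1"
  shows "(\<lambda>k. trace (matrix_power X (Suc k)) * z ^ k) sums trace (N ** X)"
proof -
  have step: "trace (N ** X) = (\<Sum>k<m. trace (matrix_power X (Suc k)) * z ^ k)
      + z ^ m * trace (matrix_power X (Suc m) ** N)" for m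
  proof (induction m)
    case 0
    then show ?case
      using trace_mul_sym[of N X] by simp
  next
    case (Suc m)
    have "matrix_power X (Suc m) ** N
        = matrix_power X (Suc m) ** ((mat 1 - mat z ** X) ** N + (mat z ** X) ** N)"
      unfolding matrix_add_rdistrib [symmetric] by simp
    also have "\<dots> = matrix_power X (Suc m) + mat z ** ((matrix_power X (Suc m) ** X) ** N)"
      by (simp only: N matrix_add_ldistrib matrix_mul_assoc matrix_mul_rid
          mat_commute[of "matrix_power X (Suc m)" z])
    also have "matrix_power X (Suc m) ** X = matrix_power X (Suc (Suc m))"
      by (rule matrix_power_commute)
    finally have "trace (matrix_power X (Suc m) ** N)
       = trace (matrix_power X (Suc m)) + z * trace (matrix_power X (Suc (Suc m)) ** N)"
      by (simp only: trace_add trace_mat_mult)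
    then show ?case
      using Suc by (simp add: algebra_simps del: matrix_power.simps)
  qed
  have "(\<lambda>m. z ^ m * trace (matrix_power X (Suc m) ** N)) \<longlonglongrightarrow> 0"
  proof (rule Lim_null_comparison)
    let ?C = "CARD('n) * opnorm X * opnorm N"
    have "norm (z ^ m * trace (matrix_power X (Suc m) ** N)) \<le> (norm z * opnorm X) ^ m * ?C" for m
    proof -
      have "opnorm (matrix_power X (Suc m) ** N) \<le> opnorm X ^ Suc m * opnorm N"
        by (rule order_trans[OF opnorm_mult mult_right_mono[OF opnorm_matrix_power]]) simp
      then have "norm (trace (matrix_power X (Suc m) ** N)) \<le> CARD('n) * (opnorm X ^ Suc m * opnorm N)"
        by (rule order_trans[OF norm_trace_le mult_left_mono]) simp
      then have "norm z ^ m * norm (trace (matrix_power X (Suc m) ** N))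
          \<le> norm z ^ m * (CARD('n) * (opnorm X ^ Suc m * opnorm N))"
        by (intro mult_left_mono) auto
      then show ?thesis
        by (simp add: norm_mult norm_power power_mult_distrib mult_ac)
    qed
    then show "\<forall>\<^sub>F m in sequentially. norm (z ^ m * trace (matrix_power X (Suc m) ** N))
        \<le> (norm z * opnorm X) ^ m * ?C"
      by simp
    show "(\<lambda>m. (norm z * opnorm X) ^ m * ?C) \<longlonglongrightarrow> 0"
      using assms(2) by (intro tendsto_mult_left_zero LIMSEQ_realpow_zero) auto
  qed
  then have "(\<lambda>m. trace (N ** X) - z ^ m * trace (matrix_power X (Suc m) ** N))
      \<longlonglongrightarrow> trace (N ** X) - 0"
    by (intro tendsto_intros)
  moreover have "(\<lambda>m. trace (N ** X) - z ^ m * trace (matrix_power X (Suc m) ** N))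
      = (\<lambda>m. \<Sum>k<m. trace (matrix_power X (Suc k)) * z ^ k)"
  proof
    show "trace (N ** X) - z ^ m * trace (matrix_power X (Suc m) ** N)
        = (\<Sum>k<m. trace (matrix_power X (Suc k)) * z ^ k)" for m
      using step[of m] by (simp only: add_diff_cancel_right')
  qed
  ultimately show ?thesis
    by (simp add: sums_def)
qed

text \<open>By Jacobi's formula and the resolvent series, the power series \<open>S\<close> cancels
  the logarithmic derivative of the determinant, so the product \<open>F\<close> is constant on the
  closed disc. Working with \<open>F\<close> requires neither eigenvalues nor a branch of the
  complex logarithm.\<close>

lemma det_mat_1_minus_eq_exp:
  fixes X :: "complex^'n^'n"
  assumes X: "opnorm X < 1"
  defines "c \<equiv> \<lambda>k. trace (matrix_power X k) / of_nat k"
  shows "summable c" and "det (mat 1 - X) = exp (- suminf c)"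
proof -
  \<comment> \<open>Convergence at a point of modulus 1 / r > 1 allows termwise differentiation on
    the whole closed unit disc, including the point 1 where the value is wanted.\<close>
  obtain r where r: "opnorm X < r" "r < 1"
    using X dense by blast
  have r0: "0 < r"
    using r(1) opnorm_nonneg[of X] by linarith
  define K where "K = complex_of_real (1 / r)"
  have K: "1 < norm K"
    using r r0 by (simp add: K_def norm_divide)
  have sm: "summable (\<lambda>k. c k * K ^ k)"
  proof (rule summable_comparison_test')
    show "summable (\<lambda>k. CARD('n) * (opnorm X / r) ^ k)"
      using r r0 by (intro summable_mult summable_geometric) auto
    show "norm (c k * K ^ k) \<le> CARD('n) * (opnorm X / r) ^ k" for k
    proof -
      have "norm (c k) \<le> norm (trace (matrix_power X k))"
      proof (cases k)
        case (Suc n)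
        then have "norm (c k) = norm (trace (matrix_power X k)) / real (Suc n)"
          by (simp add: c_def norm_divide del: matrix_power.simps of_nat_Suc)
        also have "\<dots> \<le> norm (trace (matrix_power X k)) / 1"
          by (intro divide_left_mono) auto
        finally show ?thesis
          by simp
      qed (simp add: c_def)
      also note trace_power_bound
      finally have "norm (c k) * (1 / r) ^ k \<le> CARD('n) * opnorm X ^ k * (1 / r) ^ k"
        using r0 by (intro mult_right_mono) auto
      then show ?thesis
        using r0 by (simp add: K_def norm_mult norm_power norm_divide power_divide)
    qed
  qed
  then show "summable c"
    using powser_inside[OF sm, of 1] K by simp
  define S where "S z = (\<Sum>k. c k * z ^ k)" for z
  define F where "F z = det (mat 1 - mat z ** X) * exp (S z)" for z
  have small: "norm z * opnorm X < 1" if "z \<in> cball 0 1" for z :: complex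
  proof -
    have "norm z * opnorm X \<le> 1 * opnorm X"
      using that by (intro mult_right_mono) auto
    then show ?thesis
      using X by simp
  qed
  have "(F has_field_derivative 0) (at z within cball 0 1)" if z: "z \<in> cball 0 1" for z
  proof -
    have "opnorm (mat z ** X) < 1"
      using small[OF z] opnorm_mat_mult[of z X] by simp
    then obtain N where N: "(mat 1 - mat z ** X) ** N = mat 1"
      using invertible_mat_1_minus unfolding invertible_def by blast
    have "(S has_field_derivative (\<Sum>k. diffs c k * z ^ k)) (at z)"
      unfolding S_def using z K by (intro termdiffs_strong[OF sm]) auto
    also have "(\<Sum>k. diffs c k * z ^ k) = trace (N ** X)"
    proof -
      have "diffs c k = trace (matrix_power X (Suc k))" for k
        by (simp add: diffs_def c_def del: matrix_power.simps of_nat_Suc)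
      then show ?thesis
        using trace_resolvent_sums[OF N small[OF z]] by (simp add: sums_iff)
    qed
    finally have S': "(S has_field_derivative trace (N ** X)) (at z)" .
    have "(F has_field_derivative
        det (mat 1 - mat z ** X) * (exp (S z) * trace (N ** X))
        + - (det (mat 1 - mat z ** X) * trace (N ** X)) * exp (S z)) (at z)"
      unfolding F_def by (rule DERIV_mult'[OF has_field_derivative_det[OF N] DERIV_fun_exp[OF S']])
    then show ?thesis
      by (simp add: has_field_derivative_at_within algebra_simps)
  qed
  then obtain k where k: "\<And>z. z \<in> cball 0 1 \<Longrightarrow> F z = k"
    using has_field_derivative_zero_constant[OF convex_cball, of 0 1 F] by blast
  \<comment> \<open>The coefficient \<open>c 0\<close> is a quotient by 0 and hence 0, so the series
    effectively starts at k = 1.\<close>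
  have "S 0 = 0"
    unfolding S_def powser_zero by (simp add: c_def)
  then have "F 1 = 1"
    using k[of 0] k[of 1] by (simp add: F_def)
  moreover have "S 1 = suminf c"
    by (simp add: S_def)
  ultimately show "det (mat 1 - X) = exp (- suminf c)"
    by (simp add: F_def exp_minus divide_eq_eq field_simps)
qed

text \<open>The norm of a complex exponential depends only on the real part of the exponent, so a
  real logarithm suffices.\<close>

lemma ln_norm_det_sums:
  fixes X :: "complex^'n^'n"
  assumes "opnorm X < 1"
  shows "(\<lambda>k. Re (trace (matrix_power X k)) / real k) sums (- ln (norm (det (mat 1 - X))))"
proof -
  let ?c = "\<lambda>k. trace (matrix_power X k) / of_nat k"
  have "(\<lambda>k. Re (?c k)) sums Re (suminf ?c)"
    by (intro sums_Re summable_sums det_mat_1_minus_eq_exp assms)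
  moreover have "ln (norm (det (mat 1 - X))) = - Re (suminf ?c)"
    by (simp add: det_mat_1_minus_eq_exp[OF assms])
  ultimately show ?thesis
    by simp
qed

section \<open>A trace inequality by reflection\<close>

text \<open>The flag \<open>s\<close> tells whether the first factor carries the adjoint.
  Alternation is imposed because the adjoint of such a product is again of this kind, with the
  letters reversed, and continues the original product without breaking the pattern.\<close>

primrec alt_word :: "('a \<Rightarrow> complex^'n^'n) \<Rightarrow> bool \<Rightarrow> 'a list \<Rightarrow> complex^'n^'n" where
  "alt_word F s [] = mat 1"
| "alt_word F s (b # w) = (if s then (F b)\<^sup>\<dagger> else F b) ** alt_word F (\<not> s) w"

lemma alt_word_append:
  "alt_word F s (u @ v) = alt_word F s u ** alt_word F (s \<noteq> odd (length u)) v"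
  by (induction u arbitrary: s) (simp_all add: matrix_mul_assoc)

lemma conj_transpose_alt_word:
  "(alt_word F s w)\<^sup>\<dagger> = alt_word F (s \<noteq> odd (length w)) (rev w)"
proof (induction w arbitrary: s)
  case (Cons b w)
  have "(alt_word F s (b # w))\<^sup>\<dagger>
      = alt_word F ((\<not> s) \<noteq> odd (length w)) (rev w) ** alt_word F (\<not> s) [b]"
    by (simp add: conj_transpose_mult Cons)
  also have "\<dots> = alt_word F (s \<noteq> odd (length (b # w))) (rev (b # w))"
    by (cases s) (simp_all add: alt_word_append)
  finally show ?case .
qed simp

lemma norm_alt_word_square:
  "(norm (alt_word F s u))\<^sup>2 = Re (trace (alt_word F s (u @ rev u)))"
proof -
  have "alt_word F s (u @ rev u) = alt_word F s u ** (alt_word F s u)\<^sup>\<dagger>"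
    by (simp only: conj_transpose_alt_word alt_word_append)
  then show ?thesis
    using norm_matrix_square[of "(alt_word F s u)\<^sup>\<dagger>"] by (simp add: norm_conj_transpose)
qed

text \<open>Absolute values keep all quantities nonnegative, so that one factor of a product may be
  bounded by the maximum over all words.\<close>

definition word_trace :: "('a \<Rightarrow> complex^'n^'n) \<Rightarrow> bool \<Rightarrow> 'a list \<Rightarrow> real" where
  "word_trace F s w = \<bar>Re (trace (alt_word F s w))\<bar>"

text \<open>Even length makes the alternation consistent around the cycle, so cyclic invariance of
  the trace applies; the starting flag shifts by the parity of the part moved.\<close>

lemma word_trace_rotate:
  assumes "even (length (u @ v))"
  shows "word_trace F s (u @ v) = word_trace F (s \<noteq> odd (length u)) (v @ u)"
proof -
  have "((s \<noteq> odd (length u)) \<noteq> odd (length v)) = s"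
    using assms by auto
  then show ?thesis
    unfolding word_trace_def alt_word_append
    using trace_mul_sym[of "alt_word F s u" "alt_word F (s \<noteq> odd (length u)) v"] by simp
qed

text \<open>Cauchy-Schwarz for the two halves: each squared Frobenius norm is the trace of a
  palindrome, since a half is continued by its own adjoint.\<close>

lemma word_trace_reflect:
  assumes "length u = length v"
  shows "(word_trace F s (u @ v))\<^sup>2
    \<le> word_trace F s (u @ rev u) * word_trace F (s \<noteq> odd (length u)) (v @ rev v)"
proof -
  have "word_trace F s (u @ v)
      \<le> norm (alt_word F s u) * norm (alt_word F (s \<noteq> odd (length u)) v)"
    unfolding word_trace_def alt_word_append by (rule abs_Re_trace_mult_le)
  then have "(word_trace F s (u @ v))\<^sup>2
      \<le> (norm (alt_word F s u))\<^sup>2 * (norm (alt_word F (s \<noteq> odd (length u)) v))\<^sup>2"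
    unfolding power_mult_distrib [symmetric] by (rule power_mono) (simp add: word_trace_def)
  also have "\<dots> \<le> word_trace F s (u @ rev u) * word_trace F (s \<noteq> odd (length u)) (v @ rev v)"
    unfolding norm_alt_word_square word_trace_def
    by (intro mult_mono abs_ge_self abs_ge_zero) (simp flip: norm_alt_word_square)
  finally show ?thesis .
qed

text \<open>
  The chessboard estimate: reflecting a word of maximal trace in its midpoint again gives a
  maximal word, and does so with a block of equal letters of twice the length.
\<close>

lemma word_trace_le_constant_word:
  fixes F :: "'a::finite \<Rightarrow> complex^'n^'n"
  assumes "length w = 2 * k"
  shows "\<exists>s' c. word_trace F s w \<le> word_trace F s' (replicate (2 * k) c)"
proof (cases "k = 0")
  case False
  define V where "V = (\<lambda>(s, w). word_trace F s w) ` (UNIV \<times> {w. length w = 2 * k})"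
  define m where "m = Max V"
  have "finite {w :: 'a list. length w = 2 * k}"
    using finite_lists_length_eq[of "UNIV :: 'a set" "2 * k"] by simp
  then have fin: "finite V"
    by (simp add: V_def)
  have mem: "word_trace F s w \<in> V" if "length w = 2 * k" for s w
    using that by (force simp: V_def)
  then have le: "word_trace F s w \<le> m" if "length w = 2 * k" for s w
    using that fin by (simp add: m_def)
  show ?thesis
  proof (cases "m = 0")
    \<comment> \<open>If the maximum is 0, any constant word serves. The other case needs a positive
      maximum in order to cancel it.\<close>
    case True
    then have "word_trace F s w \<le> word_trace F s (replicate (2 * k) undefined)"
      using le[OF assms, of s] by (simp add: word_trace_def)
    then show ?thesis
      by blast
  next
    case False
    then have "0 < m"
      using le[OF assms, of s] by (simp add: word_trace_def)
    \<comment> \<open>The quantity to be increased is the length of the constant block at the start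
      of some maximal word; \<open>P (2 * k)\<close> says that a constant word is maximal.\<close>
    define P where "P l \<longleftrightarrow> (\<exists>s c w. length w + l = 2 * k \<and> word_trace F s (replicate l c @ w) = m)" for l
    have mono: "P l" if "P l'" "l \<le> l'" for l l'
    proof -
      from that(1) obtain s c w where
        w: "length w + l' = 2 * k" "word_trace F s (replicate l' c @ w) = m"
        unfolding P_def by blast
      moreover have "replicate l' c = replicate l c @ replicate (l' - l) c"
        using that(2) by (simp flip: replicate_add)
      ultimately show ?thesis
        unfolding P_def using that(2)
        by (intro exI[of _ s] exI[of _ c] exI[of _ "replicate (l' - l) c @ w"]) simp
    qed
    \<comment> \<open>The condition l \<le> k places the whole block in the first half
      \<open>u\<close>. The palindrome then also ends with a copy of the block, and rotation joins
      the two copies.\<close>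
    have double: "P (2 * l)" if "P l" "l \<le> k" for l
    proof -
      from that(1) obtain s c w where
        w: "length w + l = 2 * k" "word_trace F s (replicate l c @ w) = m"
        unfolding P_def by blast
      define w1 where "w1 = take (k - l) w"
      define v where "v = drop (k - l) w"
      define u where "u = replicate l c @ w1"
      have len: "length w1 = k - l" "length u = k" "length v = k"
        using w(1) that(2) by (simp_all add: w1_def v_def u_def)
      have uv: "replicate l c @ w = u @ v"
        by (simp add: u_def w1_def v_def)
      have "m * m \<le> word_trace F s (u @ rev u) * word_trace F (s \<noteq> odd (length u)) (v @ rev v)"
        using word_trace_reflect[of u v F s] w(2) len by (simp add: uv power2_eq_square)
      also have "\<dots> \<le> word_trace F s (u @ rev u) * m"
        using len by (intro mult_left_mono le) (simp_all add: word_trace_def)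
      finally have "m \<le> word_trace F s (u @ rev u)"
        using \<open>0 < m\<close> by simp
      then have "m = word_trace F s (u @ rev u)"
        using le[of "u @ rev u" s] len by simp
      also have "u @ rev u = (replicate l c @ w1 @ rev w1) @ replicate l c"
        by (simp add: u_def)
      also have "word_trace F s \<dots> = word_trace F (s \<noteq> odd (length (replicate l c @ w1 @ rev w1)))
          (replicate l c @ replicate l c @ w1 @ rev w1)"
        by (rule word_trace_rotate) auto
      finally have "m = word_trace F (s \<noteq> odd (length (replicate l c @ w1 @ rev w1)))
          (replicate (2 * l) c @ w1 @ rev w1)"
        by (simp add: mult_2 replicate_add)
      moreover have "length (w1 @ rev w1) + 2 * l = 2 * k"
        using len that(2) by simp
      ultimately show ?thesis
        unfolding P_def by metis
    qed
    \<comment> \<open>Doubling and then shortening leads from l to l + 1. All lengths up to k are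
      reached in this way, so that the final doubling lands exactly on 2 * k, whether or not k is a
      power of 2.\<close>
    have "P l" if "1 \<le> l" "l \<le> k" for l
      using that
    proof (induction l rule: nat_induct_at_least)
      case base
      have "m \<in> V"
        unfolding m_def using fin mem[of "replicate (2 * k) undefined"] by (intro Max_in) auto
      then obtain s w where w: "length w = 2 * k" "m = word_trace F s w"
        by (auto simp: V_def)
      moreover obtain c w' where "w = c # w'"
        using w(1) \<open>k \<noteq> 0\<close> by (cases w) auto
      ultimately show ?case
        unfolding P_def by (intro exI[of _ s] exI[of _ c] exI[of _ w']) simp
    next
      case (Suc l)
      then show ?case
        using double[of l] mono[of "2 * l" "Suc l"] by simp
    qed
    then have "P (2 * k)"
      using double[of k] \<open>k \<noteq> 0\<close> by simp
    then show ?thesis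
      unfolding P_def using le[OF assms, of s] by force
  qed
qed (use assms in auto)

lemma alt_word_replicate: "alt_word F True (replicate (2 * k) c) = matrix_power ((F c)\<^sup>\<dagger> ** F c) k"
  by (induction k) (simp_all add: matrix_mul_assoc)

text \<open>The product of 2k alternating factors is cut after k of them, possibly inside a factor
  \<open>A\<^sup>\<dagger> ** A\<close>. The halves are adjoint to each other, so the trace is a
  squared Frobenius norm for odd k as well.\<close>

lemma trace_gram_power_nonneg:
  fixes A :: "complex^'n^'n"
  shows "0 \<le> Re (trace (matrix_power (A\<^sup>\<dagger> ** A) k))"
proof -
  have "Re (trace (matrix_power (A\<^sup>\<dagger> ** A) k)) = (norm (alt_word (\<lambda>_. A) True (replicate k ())))\<^sup>2"
    unfolding norm_alt_word_square
    by (simp add: mult_2 flip: alt_word_replicate[of "\<lambda>_. A" k "()"] replicate_add)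
  then show ?thesis
    by simp
qed

text \<open>Rotation by one letter turns a plain first factor into an adjoint one, so both starting
  flags give the same value; nonnegativity removes the absolute value.\<close>

lemma word_trace_replicate:
  "word_trace F s (replicate (2 * k) c) = Re (trace (matrix_power ((F c)\<^sup>\<dagger> ** F c) k))"
proof -
  have True: "word_trace F True (replicate (2 * k) c) = Re (trace (matrix_power ((F c)\<^sup>\<dagger> ** F c) k))"
    by (simp add: word_trace_def alt_word_replicate trace_gram_power_nonneg)
  show ?thesis
  proof (cases "s \<or> k = 0")
    case False
    then obtain j where j: "2 * k = Suc j"
      by (cases "2 * k") auto
    have "word_trace F s (replicate (2 * k) c) = word_trace F s ([c] @ replicate j c)"
      by (simp add: j)
    also have "\<dots> = word_trace F (s \<noteq> odd (length [c])) (replicate j c @ [c])"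
      using arg_cong[OF j, of even] by (intro word_trace_rotate) simp
    also have "\<dots> = word_trace F True (replicate (2 * k) c)"
      using False by (simp add: j replicate_append_same)
    finally show ?thesis
      using True by simp
  qed (use True in \<open>auto simp: word_trace_def\<close>)
qed

lemma abs_trace_power_le_max:
  fixes A C :: "complex^'n^'n"
  shows "\<bar>Re (trace (matrix_power (A\<^sup>\<dagger> ** C) k))\<bar>
    \<le> max (Re (trace (matrix_power (A\<^sup>\<dagger> ** A) k))) (Re (trace (matrix_power (C\<^sup>\<dagger> ** C) k)))"
proof -
  \<comment> \<open>Over the alphabet of two letters, the mixed power is the word that repeats True,
    False. The chessboard estimate does not say which constant word dominates, hence the
    maximum.\<close>
  define F where "F b = (if b then A else C)" for b
  define w where "w = concat (replicate k [True, False])"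
  have "alt_word F True w = matrix_power (A\<^sup>\<dagger> ** C) k"
    unfolding w_def by (induction k) (simp_all add: F_def matrix_mul_assoc)
  moreover have "length w = 2 * k"
    unfolding w_def by (induction k) simp_all
  then obtain s c where "word_trace F True w \<le> word_trace F s (replicate (2 * k) c)"
    using word_trace_le_constant_word by blast
  ultimately have "\<bar>Re (trace (matrix_power (A\<^sup>\<dagger> ** C) k))\<bar>
      \<le> Re (trace (matrix_power ((F c)\<^sup>\<dagger> ** F c) k))"
    by (simp add: word_trace_replicate) (simp add: word_trace_def)
  then show ?thesis
    by (cases c) (simp_all add: F_def)
qed

section \<open>From the maximum to the geometric mean, and summation over the powers\<close>

lemma scaleR_matrix_mult: "(r *\<^sub>R A) ** B = r *\<^sub>R (A ** (B :: complex^'k^'n))"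
  by (simp add: vec_eq_iff matrix_matrix_mult_def scaleR_sum_right)

lemma matrix_mult_scaleR: "A ** (r *\<^sub>R B) = r *\<^sub>R (A ** (B :: complex^'k^'n))"
  by (simp add: vec_eq_iff matrix_matrix_mult_def scaleR_sum_right)

lemma scaleR_matrix_vector_mult: "(r *\<^sub>R A) *v x = r *\<^sub>R (A *v (x :: complex^'n))"
  by (simp add: vec_eq_iff matrix_vector_mult_def scaleR_sum_right)

lemma matrix_power_scaleR:
  "matrix_power (r *\<^sub>R A) k = r ^ k *\<^sub>R matrix_power (A :: complex^'n^'n) k"
  by (induction k) (simp_all add: scaleR_matrix_mult matrix_mult_scaleR)

lemma trace_scaleR: "trace (r *\<^sub>R A) = r *\<^sub>R trace (A :: complex^'n^'n)"
  by (simp add: trace_def scaleR_sum_right)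

text \<open>The choice u = sqrt (c / a) balances both arguments of the maximum at sqrt (a * c).
  Adding e > 0 to a and c avoids division by zero and disappears in the limit.\<close>

lemma square_le_mult_if_le_max_scaled:
  fixes x a c :: real
  assumes "\<And>u. 0 < u \<Longrightarrow> \<bar>x\<bar> \<le> max (u * a) (c / u)" and "0 \<le> a" "0 \<le> c"
  shows "x\<^sup>2 \<le> a * c"
proof (rule tendsto_lowerbound)
  show "((\<lambda>e. (a + e) * (c + e)) \<longlongrightarrow> a * c) (at_right 0)"
    by (auto intro!: tendsto_eq_intros)
  have "x\<^sup>2 \<le> (a + e) * (c + e)" if "0 < e" for e
  proof -
    define p q where "p = sqrt (a + e)" and "q = sqrt (c + e)"
    have pq: "0 < p" "0 < q" "p\<^sup>2 = a + e" "q\<^sup>2 = c + e"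
      using that assms(2,3) by (simp_all add: p_def q_def)
    have "q / p * a \<le> q / p * p\<^sup>2"
      using pq that by (intro mult_left_mono) auto
    moreover have "q / p * p\<^sup>2 = p * q" "q\<^sup>2 / (q / p) = p * q"
      using pq(1,2) by (simp_all add: power2_eq_square)
    moreover have "c / (q / p) \<le> q\<^sup>2 / (q / p)"
      using pq that by (intro divide_right_mono) auto
    moreover have "\<bar>x\<bar> \<le> max (q / p * a) (c / (q / p))"
      using pq(1,2) by (intro assms(1)) simp
    ultimately have "\<bar>x\<bar> \<le> p * q"
      by linarith
    then have "x\<^sup>2 \<le> (p * q)\<^sup>2"
      using pq by (simp flip: abs_le_square_iff add: abs_mult)
    then show ?thesis
      using pq by (simp add: power_mult_distrib)
  qed
  then show "\<forall>\<^sub>F e in at_right 0. x\<^sup>2 \<le> (a + e) * (c + e)"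
    by (auto simp: eventually_at_right_less intro: eventually_at_right_less eventually_mono)
qed simp

lemma trace_power_square_le:
  fixes A C :: "complex^'n^'n"
  assumes "0 < k"
  shows "(Re (trace (matrix_power (A\<^sup>\<dagger> ** C) k)))\<^sup>2
    \<le> Re (trace (matrix_power (A\<^sup>\<dagger> ** A) k)) * Re (trace (matrix_power (C\<^sup>\<dagger> ** C) k))"
proof (rule square_le_mult_if_le_max_scaled)
  fix u :: real
  assume "0 < u"
  \<comment> \<open>Multiplying A by t and C by 1 / t preserves
    \<open>A\<^sup>\<dagger> ** C\<close>. The pure traces are homogeneous of degree 2k, so this t
    multiplies the first by u and divides the second by u.\<close>
  define t where "t = root (2 * k) u"
  have t: "0 < t" "(t * t) ^ k = u"
    using \<open>0 < u\<close> assms by (simp_all add: t_def flip: power2_eq_square power_mult)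
  have "((1 / t) * (1 / t)) ^ k = 1 / u"
    using t by (simp add: power_divide power_mult_distrib)
  then show "\<bar>Re (trace (matrix_power (A\<^sup>\<dagger> ** C) k))\<bar>
      \<le> max (u * Re (trace (matrix_power (A\<^sup>\<dagger> ** A) k)))
            (Re (trace (matrix_power (C\<^sup>\<dagger> ** C) k)) / u)"
    using abs_trace_power_le_max[of "t *\<^sub>R A" "(1 / t) *\<^sub>R C" k] t
    by (simp add: conj_transpose_scaleR scaleR_matrix_mult matrix_mult_scaleR matrix_power_scaleR
        trace_scaleR del: power_one_over)
qed (simp_all add: trace_gram_power_nonneg)

lemma Cauchy_Schwarz_sums:
  fixes x a c :: "nat \<Rightarrow> real"
  assumes "\<And>k. (x k)\<^sup>2 \<le> a k * c k" "\<And>k. 0 \<le> a k" "\<And>k. 0 \<le> c k"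
    and "x sums s" "a sums p" "c sums q"
  shows "\<bar>s\<bar> \<le> sqrt p * sqrt q"
proof (rule tendsto_upperbound)
  show "(\<lambda>n. \<bar>\<Sum>k<n. x k\<bar>) \<longlonglongrightarrow> \<bar>s\<bar>"
    using assms(4) by (simp add: sums_def tendsto_rabs)
  have "\<bar>\<Sum>k<n. x k\<bar> \<le> sqrt p * sqrt q" for n
  proof -
    have "\<bar>x k\<bar> \<le> \<bar>sqrt (a k)\<bar> * \<bar>sqrt (c k)\<bar>" for k
      using real_sqrt_le_mono[OF assms(1)[of k]] assms(2,3)[of k] by (simp add: real_sqrt_mult)
    then have "\<bar>\<Sum>k<n. x k\<bar> \<le> (\<Sum>k<n. \<bar>sqrt (a k)\<bar> * \<bar>sqrt (c k)\<bar>)"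
      by (intro order_trans[OF sum_abs] sum_mono)
    also have "\<dots> \<le> sqrt (\<Sum>k<n. a k) * sqrt (\<Sum>k<n. c k)"
      using L2_set_mult_ineq[of "\<lambda>k. sqrt (a k)" "\<lambda>k. sqrt (c k)" "{..<n}"] assms(2,3)
      by (simp add: L2_set_def)
    also have "\<dots> \<le> sqrt p * sqrt q"
      using assms by (intro mult_mono real_sqrt_le_mono)
        (auto simp: sums_iff intro!: sum_le_suminf sum_nonneg suminf_nonneg)
    finally show ?thesis .
  qed
  then show "\<forall>\<^sub>F n in sequentially. \<bar>\<Sum>k<n. x k\<bar> \<le> sqrt p * sqrt q"
    by simp
qed simp

section \<open>Determinants on the ball\<close>

lemma opnorm_conj_transpose_mult_less_1:
  assumes "opnorm A < 1" "opnorm B < 1"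
  shows "opnorm (A\<^sup>\<dagger> ** B) < 1"
proof -
  have "opnorm (A\<^sup>\<dagger> ** B) \<le> opnorm A * opnorm B"
    by (rule order_trans[OF opnorm_mult mult_right_mono[OF opnorm_conj_transpose_le]]) simp
  also have "\<dots> \<le> 1 * opnorm B"
    using assms by (intro mult_right_mono) auto
  finally show ?thesis
    using assms by simp
qed

lemma abs_ln_norm_det_le:
  fixes A C :: "complex^'n^'n"
  assumes "opnorm A < 1" "opnorm C < 1"
  shows "\<bar>ln (norm (det (mat 1 - A\<^sup>\<dagger> ** C)))\<bar>
    \<le> sqrt (- ln (norm (det (mat 1 - A\<^sup>\<dagger> ** A)))) * sqrt (- ln (norm (det (mat 1 - C\<^sup>\<dagger> ** C))))"
proof -
  let ?t = "\<lambda>X Y k. Re (trace (matrix_power (X\<^sup>\<dagger> ** Y) k)) / real k"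
  note less_1 = opnorm_conj_transpose_mult_less_1
  \<comment> \<open>At k = 0 all three terms are quotients by 0 and vanish; for k \<ge> 1 the
    squared weight 1 / k^2 is shared equally by the two factors on the right.\<close>
  have "(?t A C k)\<^sup>2 \<le> ?t A A k * ?t C C k" for k
    using trace_power_square_le[of k A C]
    by (cases "k = 0") (simp_all add: power2_eq_square divide_right_mono)
  then have "\<bar>- ln (norm (det (mat 1 - A\<^sup>\<dagger> ** C)))\<bar>
    \<le> sqrt (- ln (norm (det (mat 1 - A\<^sup>\<dagger> ** A)))) * sqrt (- ln (norm (det (mat 1 - C\<^sup>\<dagger> ** C))))"
    by (rule Cauchy_Schwarz_sums[where x = "?t A C"])
      (auto intro!: ln_norm_det_sums less_1 assms divide_nonneg_nonneg trace_gram_power_nonneg)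
  then show ?thesis
    by simp
qed

lemma ln_norm_det_gram_le_0:
  fixes A :: "complex^'n^'n"
  assumes "opnorm A < 1"
  shows "ln (norm (det (mat 1 - A\<^sup>\<dagger> ** A))) \<le> 0"
    and "ln (norm (det (mat 1 - A\<^sup>\<dagger> ** A))) = 0 \<Longrightarrow> A = 0"
proof -
  let ?t = "\<lambda>k. Re (trace (matrix_power (A\<^sup>\<dagger> ** A) k)) / real k"
  have sums: "?t sums (- ln (norm (det (mat 1 - A\<^sup>\<dagger> ** A))))"
    by (intro ln_norm_det_sums opnorm_conj_transpose_mult_less_1 assms)
  have nonneg: "0 \<le> ?t k" for k
    by (intro divide_nonneg_nonneg trace_gram_power_nonneg) simp
  \<comment> \<open>A single term bounds the sum of the nonnegative series from below. The term at 1
    is the squared Frobenius norm, which yields the sign and definiteness together.\<close>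
  have "?t 1 \<le> - ln (norm (det (mat 1 - A\<^sup>\<dagger> ** A)))"
    using sum_le_suminf[of ?t "{1}"] sums nonneg by (simp add: sums_iff)
  moreover have "?t 1 = (norm A)\<^sup>2"
    by (simp add: norm_matrix_square)
  ultimately have "(norm A)\<^sup>2 \<le> - ln (norm (det (mat 1 - A\<^sup>\<dagger> ** A)))"
    by simp
  then show "ln (norm (det (mat 1 - A\<^sup>\<dagger> ** A))) \<le> 0"
    and "ln (norm (det (mat 1 - A\<^sup>\<dagger> ** A))) = 0 \<Longrightarrow> A = 0"
    using zero_le_power2[of "norm A"] by (linarith, simp)
qed

lemma det_gram_pos:
  fixes A :: "complex^'n^'n"
  assumes "opnorm A < 1"
  shows "det (mat 1 - A\<^sup>\<dagger> ** A) \<in> \<real>" and "0 < Re (det (mat 1 - A\<^sup>\<dagger> ** A))"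
proof -
  have real: "det (mat 1 - A\<^sup>\<dagger> ** A) \<in> \<real>" for A :: "complex^'n^'n"
  proof -
    have "(mat 1 - A\<^sup>\<dagger> ** A)\<^sup>\<dagger> = mat 1 - A\<^sup>\<dagger> ** A"
      by (simp add: conj_transpose_diff conj_transpose_mult)
    then show ?thesis
      by (metis det_conj_transpose Reals_cnj_iff)
  qed
  \<comment> \<open>The segment from 0 to A stays in the ball. Along it the determinant is real and
    nonzero, and it equals 1 at 0, so it cannot become negative.\<close>
  define f where "f t = Re (det (mat 1 - (t *\<^sub>R A)\<^sup>\<dagger> ** (t *\<^sub>R A)))" for t
  have "f t \<noteq> 0" if "0 \<le> t" "t \<le> 1" for t
  proof -
    have "opnorm (t *\<^sub>R A) \<le> opnorm A"
    proof (rule opnorm_le)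
      fix x
      have "norm ((t *\<^sub>R A) *v x) = t * norm (A *v x)"
        using that by (simp add: scaleR_matrix_vector_mult)
      also have "\<dots> \<le> 1 * norm (A *v x)"
        using that by (intro mult_right_mono) auto
      finally show "norm ((t *\<^sub>R A) *v x) \<le> opnorm A * norm x"
        using norm_matrix_vector_le[of A x] by simp
    qed
    then have "det (mat 1 - (t *\<^sub>R A)\<^sup>\<dagger> ** (t *\<^sub>R A)) \<noteq> 0"
      using assms invertible_mat_1_minus opnorm_conj_transpose_mult_less_1[of "t *\<^sub>R A" "t *\<^sub>R A"]
      by (auto simp: invertible_det_nz)
    then show ?thesis
      using real[of "t *\<^sub>R A"] by (metis complex_is_Real_iff complex_eqI f_def zero_complex.simps)
  qed
  moreover have "continuous_on {0..1} f"
    unfolding f_def det_def conj_transpose_scaleR scaleR_matrix_mult matrix_mult_scaleR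
      vector_minus_component vector_scaleR_component by (intro continuous_intros)
  moreover have "f 0 = 1"
    by (simp add: f_def)
  ultimately have "0 < f 1"
    using IVT2'[of f 1 0 0] by (metis atLeastAtMost_iff linorder_not_less order_refl zero_le_one)
  then show "0 < Re (det (mat 1 - A\<^sup>\<dagger> ** A))"
    by (simp add: f_def)
  show "det (mat 1 - A\<^sup>\<dagger> ** A) \<in> \<real>"
    by (rule real)
qed

section \<open>Moebius transformations\<close>

text \<open>With R = I - Y the equation for R reads Y = (\<open>B\<^sup>\<dagger> ** B\<close> +
  Y^2) / 2. The right-hand side is a contraction on Hermitian matrices of operator norm at most b,
  so Banach's fixed point theorem replaces the spectral theorem; b < 1 also makes I - Y
  invertible.\<close>

lemma hermitian_square_root:
  fixes B :: "complex^'n^'n"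
  assumes "opnorm B < 1"
  obtains R where "R\<^sup>\<dagger> = R" "invertible R" "R ** R = mat 1 - B\<^sup>\<dagger> ** B"
proof -
  define b where "b = opnorm B"
  have b: "0 \<le> b" "b < 1"
    using assms by (simp_all add: b_def)
  \<comment> \<open>The norm bound is stated vector by vector, so that \<open>S\<close> is visibly
    an intersection of closed conditions.\<close>
  define S where "S = {Y :: complex^'n^'n. Y\<^sup>\<dagger> = Y \<and> (\<forall>x. norm (Y *v x) \<le> b * norm x)}"
  define f where "f Y = (1 / 2) *\<^sub>R (B\<^sup>\<dagger> ** B + Y ** Y)" for Y
  have opS: "opnorm Y \<le> b" if "Y \<in> S" for Y
    using that by (auto simp: S_def intro: opnorm_le)
  have "closed S"
  proof -
    have "linear (conj_transpose :: complex^'n^'n \<Rightarrow> complex^'n^'n)"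
      by (rule linearI) (simp_all add: conj_transpose_add conj_transpose_scaleR)
    then have "continuous_on UNIV (conj_transpose :: complex^'n^'n \<Rightarrow> complex^'n^'n)"
      by (simp add: linear_continuous_on linear_linear)
    moreover have "continuous_on UNIV (\<lambda>Y :: complex^'n^'n. Y *v x)" for x
    proof -
      have "linear (\<lambda>Y :: complex^'n^'n. Y *v x)"
        by (rule linearI) (simp_all add: matrix_vector_mult_add_rdistrib scaleR_matrix_vector_mult)
      then show ?thesis
        by (simp add: linear_continuous_on linear_linear)
    qed
    ultimately show ?thesis
      unfolding S_def by (intro closed_Collect_conj closed_Collect_eq closed_Collect_all
          closed_Collect_le continuous_intros)
  qed
  have "f ` S \<subseteq> S"
  proof safe
    fix Y
    assume Y: "Y \<in> S"
    have "(f Y)\<^sup>\<dagger> = f Y"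
      using Y by (simp add: S_def f_def conj_transpose_scaleR conj_transpose_add conj_transpose_mult)
    moreover have "norm (f Y *v x) \<le> b * norm x" for x
    proof -
      have "opnorm (B\<^sup>\<dagger> ** B) \<le> b * b"
        unfolding b_def
        by (rule order_trans[OF opnorm_mult mult_right_mono[OF opnorm_conj_transpose_le]]) simp
      also have bb: "b * b \<le> b"
        using b by (simp add: mult_left_le)
      finally have 1: "norm ((B\<^sup>\<dagger> ** B) *v x) \<le> b * norm x"
        by (meson mult_right_mono norm_ge_zero norm_matrix_vector_le order_trans)
      have "opnorm (Y ** Y) \<le> b * b"
        by (rule order_trans[OF opnorm_mult mult_mono]) (use opS[OF Y] b in auto)
      then have 2: "norm ((Y ** Y) *v x) \<le> b * norm x"
        using bb by (meson mult_right_mono norm_ge_zero norm_matrix_vector_le order_trans)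
      have "f Y *v x = (1 / 2) *\<^sub>R ((B\<^sup>\<dagger> ** B) *v x + (Y ** Y) *v x)"
        by (simp add: f_def matrix_vector_mult_add_rdistrib scaleR_matrix_vector_mult)
      then have "norm (f Y *v x) \<le> (norm ((B\<^sup>\<dagger> ** B) *v x) + norm ((Y ** Y) *v x)) / 2"
        using norm_triangle_ineq[of "(B\<^sup>\<dagger> ** B) *v x" "(Y ** Y) *v x"] by simp
      then show ?thesis
        using 1 2 by simp
    qed
    ultimately show "f Y \<in> S"
      by (simp add: S_def)
  qed
  moreover have "dist (f Y) (f Z) \<le> b * dist Y Z" if "Y \<in> S" "Z \<in> S" for Y Z
  proof -
    \<comment> \<open>The difference of squares is split in a form valid for matrices that do not
      commute. Distances are Frobenius norms while \<open>S\<close> bounds operator norms, so each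
      product is estimated with one norm of each kind.\<close>
    have "f Y - f Z = (1 / 2) *\<^sub>R (Y ** (Y - Z) + (Y - Z) ** Z)"
      by (simp add: f_def matrix_diff_ldistrib matrix_diff_rdistrib algebra_simps)
    then have "dist (f Y) (f Z) = norm (Y ** (Y - Z) + (Y - Z) ** Z) / 2"
      by (simp add: dist_norm)
    also have "\<dots> \<le> (opnorm Y * norm (Y - Z) + norm (Y - Z) * opnorm Z) / 2"
      by (intro divide_right_mono norm_triangle_le add_mono norm_matrix_mult_le_opnorm_norm
          norm_matrix_mult_le_norm_opnorm) simp
    also have "\<dots> \<le> (b * norm (Y - Z) + norm (Y - Z) * b) / 2"
      using opS that by (intro divide_right_mono add_mono mult_mono) (auto simp: b)
    finally show ?thesis
      by (simp add: dist_norm mult.commute)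
  qed
  moreover have "S \<noteq> {}"
    using b by (auto simp: S_def intro!: exI[of _ 0])
  ultimately obtain Y where Y: "Y \<in> S" "f Y = Y"
    using Banach_fix[of S b f] \<open>closed S\<close> b by (auto simp: complete_eq_closed)
  have "2 *\<^sub>R Y = 2 *\<^sub>R f Y"
    by (simp only: Y(2))
  then have "Y + Y = B\<^sup>\<dagger> ** B + Y ** Y"
    by (simp add: f_def scaleR_2)
  then have "(mat 1 - Y) ** (mat 1 - Y) = mat 1 - B\<^sup>\<dagger> ** B"
    by (simp add: matrix_diff_ldistrib matrix_diff_rdistrib algebra_simps)
  moreover have "(mat 1 - Y)\<^sup>\<dagger> = mat 1 - Y"
    using Y(1) by (simp add: S_def conj_transpose_diff)
  moreover have "invertible (mat 1 - Y)"
    using opS[OF Y(1)] b by (intro invertible_mat_1_minus) simp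
  ultimately show ?thesis
    using that by blast
qed

lemma hermitian_inverse:
  fixes R :: "complex^'n^'n"
  assumes "R\<^sup>\<dagger> = R" "invertible R"
  obtains P where "P\<^sup>\<dagger> = P" "R ** P = mat 1" "P ** R = mat 1"
proof -
  obtain P where P: "R ** P = mat 1" "P ** R = mat 1"
    using assms(2) unfolding invertible_def by blast
  have "P\<^sup>\<dagger> ** R = mat 1"
    using arg_cong[OF P(1), of conj_transpose] by (simp add: conj_transpose_mult assms(1))
  then have "P\<^sup>\<dagger> = P"
    by (metis P(1) matrix_mul_assoc matrix_mul_lid matrix_mul_rid)
  then show ?thesis
    using that P by blast
qed

text \<open>The scalar model is (1 - a'b)(1 - b'c) - (a' - b')(c - b) = (1 - b'b)(1 - a'c), the
  prime being complex conjugation, divided by 1 - b'b. In the matrix form this factor becomes two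
  different inverses, G and H; the relations \<open>BH\<close> and \<open>HB\<close> exchange them
  across B and its adjoint, after which the expansion cancels.\<close>

lemma moebius_identity:
  fixes A B C G H :: "complex^'n^'n"
  assumes G: "G ** (mat 1 - B ** B\<^sup>\<dagger>) = mat 1"
    and H: "(mat 1 - B\<^sup>\<dagger> ** B) ** H = mat 1" "H ** (mat 1 - B\<^sup>\<dagger> ** B) = mat 1"
  shows "(mat 1 - A\<^sup>\<dagger> ** B) ** H ** (mat 1 - B\<^sup>\<dagger> ** C) - (A - B)\<^sup>\<dagger> ** G ** (C - B)
    = mat 1 - A\<^sup>\<dagger> ** C"
proof -
  have "G ** (mat 1 - B ** B\<^sup>\<dagger>) ** B ** H = G ** B ** ((mat 1 - B\<^sup>\<dagger> ** B) ** H)"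
    by (simp add: matrix_diff_ldistrib matrix_diff_rdistrib matrix_mul_assoc)
  then have BH: "B ** H = G ** B"
    by (simp add: G H)
  have HB: "H ** B\<^sup>\<dagger> = B\<^sup>\<dagger> ** G"
  proof -
    have "H ** B\<^sup>\<dagger> = H ** B\<^sup>\<dagger> ** (mat 1 - B ** B\<^sup>\<dagger>) ** G'" if "(mat 1 - B ** B\<^sup>\<dagger>) ** G' = mat 1" for G'
      by (metis that matrix_mul_assoc matrix_mul_rid)
    moreover have "(mat 1 - B ** B\<^sup>\<dagger>) ** G = mat 1"
      using G by (simp add: matrix_left_right_inverse)
    ultimately have "H ** B\<^sup>\<dagger> = H ** (mat 1 - B\<^sup>\<dagger> ** B) ** B\<^sup>\<dagger> ** G"
      by (simp add: matrix_diff_ldistrib matrix_diff_rdistrib matrix_mul_assoc)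
    then show ?thesis
      by (simp add: H)
  qed
  have 1: "A\<^sup>\<dagger> ** B ** H = A\<^sup>\<dagger> ** G ** B"
    by (simp add: BH flip: matrix_mul_assoc)
  have 2: "H ** B\<^sup>\<dagger> ** C = B\<^sup>\<dagger> ** G ** C"
    by (simp add: HB)
  have 3: "B\<^sup>\<dagger> ** G ** B = H - mat 1"
    using H(2) by (simp add: matrix_diff_ldistrib matrix_mul_assoc algebra_simps flip: HB)
  have 4: "A\<^sup>\<dagger> ** G ** B ** B\<^sup>\<dagger> ** C = A\<^sup>\<dagger> ** G ** C - A\<^sup>\<dagger> ** C"
  proof -
    have "G ** B ** B\<^sup>\<dagger> = G - mat 1"
      using G by (simp add: matrix_diff_ldistrib matrix_mul_assoc algebra_simps)
    moreover have "A\<^sup>\<dagger> ** G ** B ** B\<^sup>\<dagger> ** C = A\<^sup>\<dagger> ** (G ** B ** B\<^sup>\<dagger>) ** C"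
      by (simp add: matrix_mul_assoc)
    ultimately show ?thesis
      by (simp add: matrix_diff_ldistrib matrix_diff_rdistrib)
  qed
  show ?thesis
    by (simp add: conj_transpose_diff matrix_diff_ldistrib matrix_diff_rdistrib matrix_mul_assoc
        1 2 3 4 algebra_simps)
qed

text \<open>The conclusion is a congruence of the matrices I -
  \<open>A\<^sup>\<dagger> ** C\<close>, since this form controls both the determinants in
  \<open>dist_sq\<close> and the quadratic form that detects membership in the ball.\<close>

lemma moebius_transformation:
  fixes B :: "complex^'n^'n"
  assumes B: "opnorm B < 1"
  shows "\<exists>(\<phi> :: complex^'n^'n \<Rightarrow> complex^'n^'n) (W :: complex^'n^'n \<Rightarrow> complex^'n^'n). \<phi> B = 0 \<and>
    (\<forall>A. opnorm A < 1 \<longrightarrow> invertible (W A) \<and> (\<phi> A = 0 \<longrightarrow> A = B)) \<and>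
    (\<forall>A C. opnorm A < 1 \<longrightarrow> opnorm C < 1 \<longrightarrow>
      mat 1 - (\<phi> A)\<^sup>\<dagger> ** \<phi> C = (W A)\<^sup>\<dagger> ** (mat 1 - A\<^sup>\<dagger> ** C) ** W C)"
proof -
  obtain R where R: "R\<^sup>\<dagger> = R" "invertible R" "R ** R = mat 1 - B\<^sup>\<dagger> ** B"
    using hermitian_square_root[OF B] by blast
  obtain P where P: "P\<^sup>\<dagger> = P" "R ** P = mat 1" "P ** R = mat 1"
    using hermitian_inverse[OF R(1,2)] by blast
  have "opnorm (B\<^sup>\<dagger>) < 1"
    using opnorm_conj_transpose_le[of B] B by simp
  then obtain S where S: "S\<^sup>\<dagger> = S" "invertible S" "S ** S = mat 1 - B ** B\<^sup>\<dagger>"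
    using hermitian_square_root[of "B\<^sup>\<dagger>"] by auto
  obtain Q where Q: "Q\<^sup>\<dagger> = Q" "S ** Q = mat 1" "Q ** S = mat 1"
    using hermitian_inverse[OF S(1,2)] by blast
  have "\<exists>N. opnorm A < 1 \<longrightarrow> (mat 1 - B\<^sup>\<dagger> ** A) ** N = mat 1 \<and> N ** (mat 1 - B\<^sup>\<dagger> ** A) = mat 1" for A
    using invertible_mat_1_minus[OF opnorm_conj_transpose_mult_less_1[OF B, of A]]
    unfolding invertible_def by blast
  then obtain M where M: "(mat 1 - B\<^sup>\<dagger> ** A) ** M A = mat 1" "M A ** (mat 1 - B\<^sup>\<dagger> ** A) = mat 1"
    if "opnorm A < 1" for A
    by metis
  \<comment> \<open>The matrix form of (a - b) / (1 - b'a). The factor Q is the inverse root of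
    \<open>mat 1 - B ** B\<^sup>\<dagger>\<close> and R the root of
    \<open>mat 1 - B\<^sup>\<dagger> ** B\<close>; they absorb the two inverses in
    \<open>moebius_identity\<close>.\<close>
  define \<phi> where "\<phi> A = Q ** (A - B) ** M A ** R" for A
  define W where "W A = M A ** R" for A
  have cancel: "U ** V ** Z = U" if "V ** Z = mat 1" for U V Z :: "complex^'n^'n"
    by (metis that matrix_mul_assoc matrix_mul_rid)
  have G: "(Q ** Q) ** (mat 1 - B ** B\<^sup>\<dagger>) = mat 1"
    by (simp add: matrix_mul_assoc cancel Q flip: S(3))
  have H: "(mat 1 - B\<^sup>\<dagger> ** B) ** (P ** P) = mat 1" "(P ** P) ** (mat 1 - B\<^sup>\<dagger> ** B) = mat 1"
    by (simp_all add: matrix_mul_assoc cancel P flip: R(3))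
  have 1: "\<phi> B = 0"
    by (simp add: \<phi>_def)
  have 2: "invertible (W A)" if "opnorm A < 1" for A
    unfolding W_def using M[OF that] R(2) by (metis invertible_def invertible_mult)
  have 3: "A = B" if "opnorm A < 1" "\<phi> A = 0" for A
  proof -
    \<comment> \<open>Multiplication by the inverses of Q, R and \<open>M A\<close> recovers A - B
      from the image, so only B is sent to 0.\<close>
    have "S ** \<phi> A ** P ** (mat 1 - B\<^sup>\<dagger> ** A)
        = (S ** Q) ** ((A - B) ** (M A ** (R ** P) ** (mat 1 - B\<^sup>\<dagger> ** A)))"
      by (simp add: \<phi>_def matrix_mul_assoc)
    then show ?thesis
      using that by (simp add: Q P M)
  qed
  have 4: "mat 1 - (\<phi> A)\<^sup>\<dagger> ** \<phi> C = (W A)\<^sup>\<dagger> ** (mat 1 - A\<^sup>\<dagger> ** C) ** W C"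
    if A: "opnorm A < 1" and C: "opnorm C < 1" for A C
  proof -
    have MA: "(M A)\<^sup>\<dagger> ** (mat 1 - A\<^sup>\<dagger> ** B) = mat 1"
      using arg_cong[OF M(1)[OF A], of conj_transpose]
      by (simp add: conj_transpose_mult conj_transpose_diff)
    have "(W A)\<^sup>\<dagger> ** ((mat 1 - A\<^sup>\<dagger> ** B) ** (P ** P) ** (mat 1 - B\<^sup>\<dagger> ** C)) ** W C
        = (R ** ((M A)\<^sup>\<dagger> ** (mat 1 - A\<^sup>\<dagger> ** B)) ** P) ** (P ** ((mat 1 - B\<^sup>\<dagger> ** C) ** M C) ** R)"
      by (simp add: W_def conj_transpose_mult R(1) matrix_mul_assoc)
    also have "\<dots> = mat 1"
      by (simp add: MA M C P)
    finally have "(W A)\<^sup>\<dagger> ** ((mat 1 - A\<^sup>\<dagger> ** B) ** (P ** P) ** (mat 1 - B\<^sup>\<dagger> ** C)) ** W C = mat 1" .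
    moreover have "(W A)\<^sup>\<dagger> ** ((A - B)\<^sup>\<dagger> ** (Q ** Q) ** (C - B)) ** W C = (\<phi> A)\<^sup>\<dagger> ** \<phi> C"
      by (simp add: W_def \<phi>_def conj_transpose_mult R(1) Q(1) matrix_mul_assoc)
    ultimately show ?thesis
      unfolding moebius_identity[OF G H, of A C, symmetric]
      by (simp add: matrix_diff_ldistrib matrix_diff_rdistrib)
  qed
  show ?thesis
    by (rule exI[of _ \<phi>], rule exI[of _ W]) (intro conjI allI impI; rule 1 2 3 4; assumption)
qed

text \<open>Congruence carries |v|^2 - |Xv|^2 to the same expression for A at Wv, which is at least
  (1 - |A|^2) |Wv|^2. Invertibility bounds |Wv| below by a multiple of |v|, which leaves a gap d
  that is uniform in v and hence a strict inequality for the operator norm.\<close>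

lemma opnorm_less_1_if_congruent:
  fixes A X W :: "complex^'n^'n"
  assumes A: "opnorm A < 1" and "invertible W"
    and eq: "mat 1 - X\<^sup>\<dagger> ** X = W\<^sup>\<dagger> ** (mat 1 - A\<^sup>\<dagger> ** A) ** W"
  shows "opnorm X < 1"
proof -
  obtain V where V: "V ** W = mat 1"
    using assms(2) unfolding invertible_def by blast
  \<comment> \<open>The summand 1 makes the later divisor positive without a separate argument that
    V is nonzero.\<close>
  define K where "K = opnorm V + 1"
  have K: "0 < K"
    unfolding K_def using opnorm_nonneg[of V] by linarith
  define d where "d = (1 - (opnorm A)\<^sup>2) / K\<^sup>2"
  have "(opnorm A)\<^sup>2 < 1"
    using A by (simp add: power_less_one_iff)
  then have d: "0 < d"
    using K by (simp add: d_def)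
  have quad: "inner v ((mat 1 - Y\<^sup>\<dagger> ** Y) *v v) = (norm v)\<^sup>2 - (norm (Y *v v))\<^sup>2"
    for Y :: "complex^'n^'n" and v
    using inner_matrix_vector[of Y v "Y *v v"]
    by (simp add: matrix_vector_mult_diff_rdistrib inner_diff_right power2_norm_eq_inner
        flip: matrix_vector_mul_assoc)
  have bound: "(norm (X *v v))\<^sup>2 \<le> (1 - d) * (norm v)\<^sup>2" for v
  proof -
    have "inner v ((mat 1 - X\<^sup>\<dagger> ** X) *v v) = inner (W *v v) ((mat 1 - A\<^sup>\<dagger> ** A) *v (W *v v))"
      by (simp add: eq inner_matrix_vector flip: matrix_vector_mul_assoc)
    then have "(norm v)\<^sup>2 - (norm (X *v v))\<^sup>2 = (norm (W *v v))\<^sup>2 - (norm (A *v (W *v v)))\<^sup>2"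
      by (simp only: quad)
    also have "\<dots> \<ge> (norm (W *v v))\<^sup>2 - (opnorm A * norm (W *v v))\<^sup>2"
      by (intro diff_left_mono power_mono norm_matrix_vector_le norm_ge_zero)
    finally have 1: "(norm v)\<^sup>2 - (norm (X *v v))\<^sup>2 \<ge> (1 - (opnorm A)\<^sup>2) * (norm (W *v v))\<^sup>2"
      by (simp add: power_mult_distrib algebra_simps)
    have "norm v = norm (V *v (W *v v))"
      by (simp add: matrix_vector_mul_assoc V)
    also have "\<dots> \<le> opnorm V * norm (W *v v)"
      by (rule norm_matrix_vector_le)
    also have "\<dots> \<le> K * norm (W *v v)"
      by (simp add: K_def mult_right_mono)
    finally have "(norm v)\<^sup>2 \<le> (K * norm (W *v v))\<^sup>2"
      by (rule power_mono) simp
    then have "d * (norm v)\<^sup>2 \<le> d * (K * norm (W *v v))\<^sup>2"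
      using d by (intro mult_left_mono) auto
    also have "\<dots> = (1 - (opnorm A)\<^sup>2) * (norm (W *v v))\<^sup>2"
      using K by (simp add: d_def power_mult_distrib)
    finally show ?thesis
      using 1 by (simp add: algebra_simps)
  qed
  have "opnorm X \<le> sqrt (max 0 (1 - d))"
  proof (rule opnorm_le)
    fix v
    have "(norm (X *v v))\<^sup>2 \<le> max 0 (1 - d) * (norm v)\<^sup>2"
      using bound[of v] by (rule order_trans) (intro mult_right_mono, auto)
    then show "norm (X *v v) \<le> sqrt (max 0 (1 - d)) * norm v"
      using real_sqrt_le_mono by (fastforce simp: real_sqrt_mult)
  qed
  also have "\<dots> < 1"
    using d by simp
  finally show ?thesis .
qed

section \<open>The metric\<close>

lemma dist_sq_eq:
  fixes A B :: "complex^'n^'n"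
  assumes "opnorm A < 1" "opnorm B < 1"
  shows "dist_sq A B = ln (norm (det (mat 1 - A\<^sup>\<dagger> ** B)))
    - ln (norm (det (mat 1 - A\<^sup>\<dagger> ** A))) / 2 - ln (norm (det (mat 1 - B\<^sup>\<dagger> ** B))) / 2"
proof -
  have nz: "det (mat 1 - A\<^sup>\<dagger> ** B) \<noteq> 0"
    using invertible_mat_1_minus[OF opnorm_conj_transpose_mult_less_1[OF assms]]
    by (simp add: invertible_det_nz)
  have gram: "norm (det (mat 1 - X\<^sup>\<dagger> ** X)) = Re (det (mat 1 - X\<^sup>\<dagger> ** X))"
    "0 < Re (det (mat 1 - X\<^sup>\<dagger> ** X))" if "opnorm X < 1" for X :: "complex^'n^'n"
    using det_gram_pos[OF that] by (auto simp: in_Reals_norm complex_is_Real_iff cmod_eq_Re)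
  show ?thesis
    using gram(2)[OF assms(1)] gram(2)[OF assms(2)] nz
    unfolding dist_sq_def gram(1)[OF assms(1)] gram(1)[OF assms(2)]
    by (simp add: ln_div ln_mult ln_sqrt)
qed

lemma dist_sq_commute: "dist_sq A B = dist_sq B A"
proof -
  have "mat 1 - A\<^sup>\<dagger> ** B = (mat 1 - B\<^sup>\<dagger> ** A)\<^sup>\<dagger>"
    by (simp add: conj_transpose_diff conj_transpose_mult)
  then show ?thesis
    unfolding dist_sq_def by (simp add: det_conj_transpose mult.commute)
qed

lemma dist_sq_0_right:
  fixes A :: "complex^'n^'n"
  assumes "opnorm A < 1"
  shows "dist_sq A 0 = - ln (norm (det (mat 1 - A\<^sup>\<dagger> ** A))) / 2"
proof -
  have "opnorm (0 :: complex^'n^'n) < 1"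
    by (simp add: onorm_zero)
  then show ?thesis
    by (simp add: dist_sq_eq[OF assms])
qed

text \<open>The triangle inequality with middle point 0, squared. The logarithms of the Gram
  determinants are -2p and -2q, so the bound sqrt (2p) * sqrt (2q) is exactly the cross term of the
  square.\<close>

lemma dist_sq_le:
  fixes A C :: "complex^'n^'n"
  assumes "opnorm A < 1" "opnorm C < 1"
  shows "dist_sq A C \<le> (sqrt (dist_sq A 0) + sqrt (dist_sq 0 C))\<^sup>2"
proof -
  define p q where "p = dist_sq A 0" and "q = dist_sq 0 C"
  have pq: "- ln (norm (det (mat 1 - A\<^sup>\<dagger> ** A))) = 2 * p" "- ln (norm (det (mat 1 - C\<^sup>\<dagger> ** C))) = 2 * q"
    using assms by (simp_all add: p_def q_def dist_sq_0_right dist_sq_commute[of 0 C])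
  have nonneg: "0 \<le> p" "0 \<le> q"
    using pq ln_norm_det_gram_le_0(1)[OF assms(1)] ln_norm_det_gram_le_0(1)[OF assms(2)] by simp_all
  have "dist_sq A C = ln (norm (det (mat 1 - A\<^sup>\<dagger> ** C))) + p + q"
    using pq by (simp add: dist_sq_eq[OF assms] field_simps)
  also have "\<dots> \<le> sqrt (2 * p) * sqrt (2 * q) + p + q"
    using abs_ln_norm_det_le[OF assms] by (simp add: pq)
  also have "\<dots> = (sqrt p + sqrt q)\<^sup>2"
    using nonneg by (simp add: power2_sum real_sqrt_mult)
  finally show ?thesis
    by (simp add: p_def q_def)
qed

text \<open>The numerator and the product of square roots both acquire the factor |det U| |det V|,
  which cancels.\<close>

lemma dist_sq_congruent:
  fixes A C U V X Y :: "complex^'n^'n"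
  assumes "invertible U" "invertible V"
    and "mat 1 - X\<^sup>\<dagger> ** Y = U\<^sup>\<dagger> ** (mat 1 - A\<^sup>\<dagger> ** C) ** V"
    and "mat 1 - X\<^sup>\<dagger> ** X = U\<^sup>\<dagger> ** (mat 1 - A\<^sup>\<dagger> ** A) ** U"
    and "mat 1 - Y\<^sup>\<dagger> ** Y = V\<^sup>\<dagger> ** (mat 1 - C\<^sup>\<dagger> ** C) ** V"
  shows "dist_sq X Y = dist_sq A C"
proof -
  have Re: "sqrt (Re (cnj z * w * z)) = norm z * sqrt (Re w)" for z w
  proof -
    have "cnj z * w * z = of_real ((norm z)\<^sup>2) * w"
      by (simp only: complex_norm_square mult_ac)
    moreover have "Re (of_real r * w) = r * Re w" for r
      by simp
    ultimately have "Re (cnj z * w * z) = (norm z)\<^sup>2 * Re w"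
      by (simp only:)
    then show ?thesis
      by (simp add: real_sqrt_mult)
  qed
  have "det (mat 1 - X\<^sup>\<dagger> ** Y) = cnj (det U) * det (mat 1 - A\<^sup>\<dagger> ** C) * det V"
    by (simp only: assms(3) det_mul det_conj_transpose)
  moreover have "det (mat 1 - X\<^sup>\<dagger> ** X) = cnj (det U) * det (mat 1 - A\<^sup>\<dagger> ** A) * det U"
    by (simp only: assms(4) det_mul det_conj_transpose)
  moreover have "det (mat 1 - Y\<^sup>\<dagger> ** Y) = cnj (det V) * det (mat 1 - C\<^sup>\<dagger> ** C) * det V"
    by (simp only: assms(5) det_mul det_conj_transpose)
  ultimately show ?thesis
    using assms(1,2) unfolding dist_sq_def by (simp only: Re) (simp add: norm_mult invertible_det_nz)
qed

lemma moebius_isometry: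
  fixes B :: "complex^'n^'n"
  assumes B: "opnorm B < 1"
  shows "\<exists>\<phi> :: complex^'n^'n \<Rightarrow> complex^'n^'n. \<phi> B = 0 \<and>
    (\<forall>A. opnorm A < 1 \<longrightarrow> opnorm (\<phi> A) < 1 \<and> (\<phi> A = 0 \<longrightarrow> A = B)) \<and>
    (\<forall>A C. opnorm A < 1 \<longrightarrow> opnorm C < 1 \<longrightarrow> dist_sq (\<phi> A) (\<phi> C) = dist_sq A C)"
proof -
  obtain \<phi> W :: "complex^'n^'n \<Rightarrow> complex^'n^'n" where *: "\<phi> B = 0"
      "\<forall>A. opnorm A < 1 \<longrightarrow> invertible (W A) \<and> (\<phi> A = 0 \<longrightarrow> A = B)"
    and eq: "\<forall>A C. opnorm A < 1 \<longrightarrow> opnorm C < 1 \<longrightarrow>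
      mat 1 - (\<phi> A)\<^sup>\<dagger> ** \<phi> C = (W A)\<^sup>\<dagger> ** (mat 1 - A\<^sup>\<dagger> ** C) ** W C"
    using moebius_transformation[OF B] by (elim exE conjE) (rule that)
  have inv: "invertible (W A)" if "opnorm A < 1" for A
    using *(2) that by simp
  have 1: "opnorm (\<phi> A) < 1" if "opnorm A < 1" for A
    by (rule opnorm_less_1_if_congruent[OF that inv[OF that] eq[rule_format, OF that that]])
  have 2: "dist_sq (\<phi> A) (\<phi> C) = dist_sq A C" if "opnorm A < 1" "opnorm C < 1" for A C
    by (rule dist_sq_congruent[OF inv[OF that(1)] inv[OF that(2)]]) (intro that eq[rule_format])+
  have 3: "A = B" if "opnorm A < 1" "\<phi> A = 0" for A
    using *(2)[rule_format, OF that(1)] that(2) by simp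
  show ?thesis
    by (intro exI[of _ \<phi>] conjI allI impI) (rule *(1) 1 2 3; assumption)+
qed

section \<open>The metric axioms\<close>

lemma dist_sq_nonneg:
  fixes A B :: "complex^'n^'n"
  assumes "opnorm A < 1" "opnorm B < 1"
  shows "0 \<le> dist_sq A B" and "dist_sq A B = 0 \<longleftrightarrow> A = B"
proof -
  obtain \<phi> :: "complex^'n^'n \<Rightarrow> complex^'n^'n" where *: "\<phi> B = 0"
    "\<forall>A. opnorm A < 1 \<longrightarrow> opnorm (\<phi> A) < 1 \<and> (\<phi> A = 0 \<longrightarrow> A = B)"
    "\<forall>A C. opnorm A < 1 \<longrightarrow> opnorm C < 1 \<longrightarrow> dist_sq (\<phi> A) (\<phi> C) = dist_sq A C"
    using moebius_isometry[OF assms(2)] by (elim exE conjE) (rule that)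
  have \<phi>: "opnorm (\<phi> A) < 1" "\<phi> A = 0 \<Longrightarrow> A = B"
    using *(2)[rule_format, OF assms(1)] by simp_all
  \<comment> \<open>With B moved to 0 the mixed determinant becomes 1, and only the Gram determinant
    of the image of A remains.\<close>
  have "dist_sq A B = dist_sq (\<phi> A) (\<phi> B)"
    using *(3) assms by simp
  then have eq: "dist_sq A B = - ln (norm (det (mat 1 - (\<phi> A)\<^sup>\<dagger> ** \<phi> A))) / 2"
    using \<phi>(1) by (simp add: dist_sq_0_right *(1))
  show "0 \<le> dist_sq A B"
    using ln_norm_det_gram_le_0(1)[OF \<phi>(1)] by (simp add: eq)
  show "dist_sq A B = 0 \<longleftrightarrow> A = B"
  proof
    assume "dist_sq A B = 0"
    then show "A = B"
      using ln_norm_det_gram_le_0(2)[OF \<phi>(1)] by (intro \<phi>(2)) (simp add: eq)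
  next
    assume "A = B"
    then have "\<phi> A = 0"
      by (simp only: *(1))
    then show "dist_sq A B = 0"
      by (simp add: eq)
  qed
qed

lemma sqrt_dist_sq_triangle:
  fixes A B C :: "complex^'n^'n"
  assumes "opnorm A < 1" "opnorm B < 1" "opnorm C < 1"
  shows "sqrt (dist_sq A C) \<le> sqrt (dist_sq A B) + sqrt (dist_sq B C)"
proof -
  obtain \<phi> :: "complex^'n^'n \<Rightarrow> complex^'n^'n" where \<phi>: "\<phi> B = 0"
    "\<forall>A. opnorm A < 1 \<longrightarrow> opnorm (\<phi> A) < 1 \<and> (\<phi> A = 0 \<longrightarrow> A = B)"
    and eq: "\<forall>A C. opnorm A < 1 \<longrightarrow> opnorm C < 1 \<longrightarrow> dist_sq (\<phi> A) (\<phi> C) = dist_sq A C"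
    using moebius_isometry[OF assms(2)] by (elim exE conjE) (rule that)
  have "opnorm (\<phi> A) < 1" "opnorm (\<phi> C) < 1"
    using \<phi>(2)[rule_format, OF assms(1)] \<phi>(2)[rule_format, OF assms(3)] by simp_all
  from dist_sq_le[OF this]
  have "dist_sq (\<phi> A) (\<phi> C) \<le> (sqrt (dist_sq (\<phi> A) (\<phi> B)) + sqrt (dist_sq (\<phi> B) (\<phi> C)))\<^sup>2"
    by (simp add: \<phi>(1))
  then have "dist_sq A C \<le> (sqrt (dist_sq A B) + sqrt (dist_sq B C))\<^sup>2"
    using eq assms by simp
  then show ?thesis
    by (intro real_le_lsqrt add_nonneg_nonneg real_sqrt_ge_zero dist_sq_nonneg(1) assms)
qed

theorem theorem7:
  shows "(\<forall>A \<in> (contraction_ball :: (complex^'n^'n) set).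
            det (mat 1 - conj_transpose A ** A) \<in> \<real> \<and>
            0 < Re (det (mat 1 - conj_transpose A ** A))) \<and>
         (\<forall>A \<in> (contraction_ball :: (complex^'n^'n) set). \<forall>B \<in> contraction_ball.
            det (mat 1 - conj_transpose A ** B) \<noteq> 0 \<and> 0 \<le> dist_sq A B) \<and>
         Metric_space (contraction_ball :: (complex^'n^'n) set) contraction_dist"
proof (intro conjI ballI)
  show "Metric_space (contraction_ball :: (complex^'n^'n) set) contraction_dist"
  proof
    fix A B C :: "complex^'n^'n"
    show "0 \<le> contraction_dist A B"
      by (auto simp: contraction_dist_def contraction_ball_def dist_sq_nonneg(1))
    show "contraction_dist A B = contraction_dist B A"
      using dist_sq_commute[of A B] by (auto simp: contraction_dist_def)
    assume "A \<in> contraction_ball" "B \<in> contraction_ball"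
    then show "contraction_dist A B = 0 \<longleftrightarrow> A = B"
      using dist_sq_nonneg(2)[of A B] by (simp add: contraction_dist_def contraction_ball_def)
    assume "C \<in> contraction_ball"
    with \<open>A \<in> contraction_ball\<close> \<open>B \<in> contraction_ball\<close>
    show "contraction_dist A C \<le> contraction_dist A B + contraction_dist B C"
      using sqrt_dist_sq_triangle[of A B C] by (simp add: contraction_dist_def contraction_ball_def)
  qed
next
  fix A :: "complex^'n^'n"
  assume "A \<in> contraction_ball"
  then have A: "opnorm A < 1"
    by (simp add: contraction_ball_def)
  show "det (mat 1 - A\<^sup>\<dagger> ** A) \<in> \<real>" "0 < Re (det (mat 1 - A\<^sup>\<dagger> ** A))"
    by (fact det_gram_pos[OF A])+
  fix B :: "complex^'n^'n"
  assume "B \<in> contraction_ball"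
  then have B: "opnorm B < 1"
    by (simp add: contraction_ball_def)
  show "det (mat 1 - A\<^sup>\<dagger> ** B) \<noteq> 0"
    using invertible_mat_1_minus[OF opnorm_conj_transpose_mult_less_1[OF A B]]
    by (simp add: invertible_det_nz)
  show "0 \<le> dist_sq A B"
    by (rule dist_sq_nonneg(1)[OF A B])
qed

end
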